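(* Let $G$ be a sequential $k_\omega$ group and let $G'\subseteq G$ be a subgroup of $G$ such that $\overline{G'}$ is not Fréchet and $\overline{G'}\neq G'$. Then $G'$ (with the subspace topology) is not sequential.
   Context: Topological groups are Hausdorff. A space $X$ is sequential if for every non-closed $A\subseteq X$ there is a sequence of points of $A$ converging to a point not in $A$. A space $X$ is Fréchet if for every $A\subseteq X$ and every $x\in\overline{A}$ there is a sequence of points of $A$ converging to $x$. A topology on $X$ is determined by a family $\mathcal K$ of subsets of $X$, each $K\in\mathcal K$ carrying a topology $\tau_K$, if $U\subseteq X$ is open exactly when $U\cap K$ is $\tau_K$-open for every $K\in\mathcal K$. A space is $k_\omega$ if its topology is determined by a countable cover $\mathcal K$ by compact Hausdorff $(K,\tau_K)$ such that for all $K,F\in\mathcal K$ the set $K\cap F$ is closed in both $K$ and $F$ and inherits the same topology from both; a $k_\omega$ group is a topological group whose underlying space is $k_\omega$. $\overline{G'}$ is the closure of $G'$ in $G$. *)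

theory Defs
  imports "HOL-Analysis.Analysis" "HOL-Algebra.Group"
begin

locale topological_group = group G for G (structure) +
  fixes T :: "'a topology"
  assumes topspace_eq_carrier: "topspace T = carrier G"
    and Hausdorff: "Hausdorff_space T"
    and continuous_mult: "continuous_map (prod_topology T T) T (\<lambda>(x, y). x \<otimes> y)"
    and continuous_inv: "continuous_map T T (\<lambda>x. inv x)"

definition sequential_space :: "'a topology \<Rightarrow> bool" where
  "sequential_space X \<longleftrightarrow>
     (\<forall>A \<subseteq> topspace X. \<not> closedin X A \<longrightarrow>
        (\<exists>\<sigma> :: nat \<Rightarrow> 'a. \<exists>x. range \<sigma> \<subseteq> A \<and> x \<notin> A \<and> limitin X \<sigma> x sequentially))"

definition Frechet_space :: "'a topology \<Rightarrow> bool" where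
  "Frechet_space X \<longleftrightarrow>
     (\<forall>A \<subseteq> topspace X. \<forall>x \<in> X closure_of A.
        \<exists>\<sigma> :: nat \<Rightarrow> 'a. range \<sigma> \<subseteq> A \<and> limitin X \<sigma> x sequentially)"

(* \<tau> K is the topology carried by the member K of the family \<K>; it is not assumed to be
   the subspace topology inherited from X. Values of \<tau> outside \<K> are irrelevant. *)
definition determined_by :: "'a topology \<Rightarrow> 'a set set \<Rightarrow> ('a set \<Rightarrow> 'a topology) \<Rightarrow> bool" where
  "determined_by X \<K> \<tau> \<longleftrightarrow>
     (\<forall>K \<in> \<K>. K \<subseteq> topspace X \<and> topspace (\<tau> K) = K) \<and>
     (\<forall>U \<subseteq> topspace X. openin X U \<longleftrightarrow> (\<forall>K \<in> \<K>. openin (\<tau> K) (U \<inter> K)))"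

definition k_omega_space :: "'a topology \<Rightarrow> bool" where
  "k_omega_space X \<longleftrightarrow>
     (\<exists>\<K> \<tau>. countable \<K> \<and> \<Union>\<K> = topspace X \<and> determined_by X \<K> \<tau> \<and>
        (\<forall>K \<in> \<K>. compact_space (\<tau> K) \<and> Hausdorff_space (\<tau> K)) \<and>
        (\<forall>K \<in> \<K>. \<forall>F \<in> \<K>.
           closedin (\<tau> K) (K \<inter> F) \<and> closedin (\<tau> F) (K \<inter> F) \<and>
           subtopology (\<tau> K) (K \<inter> F) = subtopology (\<tau> F) (K \<inter> F)))"

end

theory Submission
  imports Defs "HOL-Library.Countable_Set_Type"
begin

text \<open>
  Suppose \<open>H\<close> is sequential. As \<open>H\<close> is not closed, some sequence \<open>b\<close> in \<open>H\<close> converges to a point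
  \<open>\<beta> \<notin> H\<close>. If for every compact \<open>L\<close> there is a null sequence in \<open>H - L\<close>, choose such sequences \<open>s n\<close>
  so that \<open>a n k = (b n)\<inverse> (b k) (s n k)\<close> avoids the \<open>n\<close>-th set of a compact exhaustion. The column
  \<open>a n\<close> converges to \<open>(b n)\<inverse> \<beta> \<notin> H\<close>, and these limits tend to \<open>\<one>\<close>; a convergent sequence of
  points \<open>a n k\<close> meets only finitely many columns, so the set of these points is sequentially closed in
  \<open>H\<close> although \<open>\<one>\<close> is in its closure.

  Otherwise a compact \<open>L\<close> eventually contains every null sequence of \<open>H\<close>. Then \<open>\<one>\<close> is not in the
  closure of \<open>H \<inter> K - L\<close> for compact \<open>K\<close>, and with \<open>K = L L\<close> this yields a sequentially open
  neighbourhood of \<open>\<one>\<close> in \<open>H\<close> inside \<open>L\<close>, so that the closure of \<open>H\<close> is locally compact. But a locally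
  compact sequential group is Frechet: a free sequence of length \<open>\<omega>\<^sub>1\<close> in a compact set contradicts
  sequentiality, so \<open>\<one>\<close> has a countable local \<open>\<pi>\<close>-base \<open>\<B>\<close> (Shapirovskii), and the sets \<open>B\<inverse> B\<close>
  with \<open>B \<in> \<B>\<close> form a neighbourhood base of \<open>\<one>\<close>.
\<close>

section \<open>The first uncountable ordinal\<close>

text \<open>This is the strict order of \<omega>_1, realised as the cardinal successor of
  \<open>natLeq\<close>, whose field consists of sets of naturals. A proper initial segment of a
  cardinal has smaller cardinality, hence is countable here.\<close>

lemma omega_one_well_order:
  includes cardinal_syntax
  obtains I :: "nat set set" and R :: "nat set rel"
  where "wf R" "trans R" "total_on I R" "R \<subseteq> I \<times> I"
    "uncountable I" "\<And>i. countable {j. (j, i) \<in> R}"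
proof -
  let ?r = "cardSuc natLeq"
  have card: "Card_order ?r"
    by (simp add: cardSuc_Card_order natLeq_Card_order)
  then have wo: "Well_order ?r"
    by (simp add: card_order_on_well_order_on)
  then have lin: "Linear_order ?r" and wf: "wf (?r - Id)"
    by (auto simp: well_order_on_def)
  have "trans (?r - Id)"
    using lin by (simp add: order_on_defs trans_diff_Id)
  have "total_on (Field ?r) (?r - Id)"
    using lin by (auto simp: order_on_defs total_on_def)
  have "?r - Id \<subseteq> Field ?r \<times> Field ?r"
    by (auto simp: Field_def)
  have "uncountable (Field ?r)"
  proof
    assume "countable (Field ?r)"
    then have "|Field ?r| \<le>o natLeq"
      by (simp add: countable_card_le_natLeq)
    then have "?r \<le>o natLeq"
      using card card_of_Field_ordIso ordIso_ordLeq_trans ordIso_symmetric by blast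
    then show False
      using cardSuc_greater[OF natLeq_Card_order] not_ordLess_ordLeq by blast
  qed
  have "countable {j. (j, i) \<in> ?r - Id}" for i
  proof (cases "i \<in> Field ?r")
    case True
    have "{j. (j, i) \<in> ?r - Id} = underS ?r i"
      by (auto simp: underS_def)
    moreover have "|underS ?r i| \<le>o natLeq"
      using card_of_underS[OF card True] cardSuc_ordLeq_ordLess[OF natLeq_Card_order card_of_Card_order]
      by blast
    ultimately show ?thesis
      by (simp add: countable_card_le_natLeq)
  next
    case False
    then have "{j. (j, i) \<in> ?r - Id} = {}"
      by (auto simp: Field_def)
    then show ?thesis by (metis countable_empty)
  qed
  show thesis
    by (rule that[of "?r - Id" "Field ?r"]) fact+
qed

section \<open>Sequences in sequential spaces and compact sets\<close>

lemma limitin_frequently_closedin: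
  assumes "limitin X \<sigma> x F" "closedin X C" "\<exists>\<^sub>F n in F. \<sigma> n \<in> C"
  shows "x \<in> C"
proof (rule ccontr)
  assume "x \<notin> C"
  then have "\<forall>\<^sub>F n in F. \<sigma> n \<in> topspace X - C"
    using assms(1,2) unfolding limitin_def by (metis Diff_iff openin_diff openin_topspace)
  then have "\<forall>\<^sub>F n in F. \<sigma> n \<notin> C"
    by (rule eventually_mono) simp
  then show False
    using assms(3) by (simp add: frequently_def)
qed

lemma finite_imp_closedin_Hausdorff:
  assumes "Hausdorff_space X" "finite S" "S \<subseteq> topspace X"
  shows "closedin X S"
  using assms by (simp add: compactin_imp_closedin finite_imp_compactin)

lemma finite_to_one_imp_strict_mono:
  fixes k :: "nat \<Rightarrow> nat"
  assumes "\<And>m. finite {i. k i = m}"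
  obtains r :: "nat \<Rightarrow> nat" where "strict_mono r" "strict_mono (k \<circ> r)"
proof -
  have "\<exists>i>i0. k i0 < k i" for i0
  proof -
    have "finite ({..i0} \<union> (\<Union>m\<in>{..k i0}. {i. k i = m}))"
      using assms by auto
    then obtain i where "i \<notin> {..i0} \<union> (\<Union>m\<in>{..k i0}. {i. k i = m})"
      using ex_new_if_finite infinite_UNIV_nat by metis
    then show ?thesis by (auto simp: not_le)
  qed
  then obtain s where s: "\<And>i. i < s i" "\<And>i. k i < k (s i)"
    by metis
  show thesis
    by (rule that[of "\<lambda>n. (s ^^ n) 0"]) (auto simp: strict_mono_Suc_iff s)
qed

lemma closedin_sequential_space:
  assumes "sequential_space T" "A \<subseteq> topspace T"
    and "\<And>\<sigma> x. range \<sigma> \<subseteq> A \<Longrightarrow> limitin T \<sigma> x sequentially \<Longrightarrow> x \<in> A"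
  shows "closedin T A"
  using assms unfolding sequential_space_def by blast

lemma closure_of_meets_openin:
  assumes "x \<in> X closure_of S" "openin X U" "x \<in> U"
  obtains y where "y \<in> S" "y \<in> U"
  using assms by (auto simp: in_closure_of)

text \<open>Unless some value recurs infinitely often, the range has an accumulation point, and
  sequentiality extracts a convergent sequence from the range. Its terms need not follow the order
  of \<open>\<sigma>\<close>, so their indices are thinned out to an increasing sequence.\<close>

lemma compactin_sequential_imp_convergent_subsequence:
  fixes \<sigma> :: "nat \<Rightarrow> 'a"
  assumes T: "Hausdorff_space T" "sequential_space T" and K: "compactin T K" "range \<sigma> \<subseteq> K"
  obtains r x where "strict_mono r" "limitin T (\<sigma> \<circ> r) x sequentially"
proof (cases "\<exists>v. infinite {k. \<sigma> k = v}")
  case True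
  then obtain v where inf: "infinite {k. \<sigma> k = v}" by blast
  obtain r :: "nat \<Rightarrow> nat" where sm: "strict_mono r" and "\<forall>n. r n \<in> {k. \<sigma> k = v}"
    using infinite_enumerate[OF inf] by (elim exE conjE)
  then have r: "\<sigma> (r n) = v" for n by simp
  moreover have "v \<in> topspace T"
    using K compactin_subset_topspace[OF K(1)] r[of 0] by blast
  ultimately show thesis
    using that[of r v] sm by (simp add: o_def)
next
  case False
  then have fin: "finite {k. \<sigma> k = v}" for v by simp
  have "infinite (range \<sigma>)"
    using fin inf_img_fin_dom[of \<sigma> UNIV] by (auto simp: vimage_def)
  then obtain z where z: "z \<in> T derived_set_of range \<sigma>"
    using compactin_imp_Bolzano_Weierstrass[OF K(1)] K(2) by blast
  let ?E = "range \<sigma> - {z}"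
  have ET: "?E \<subseteq> topspace T"
    using K compactin_subset_topspace by fastforce
  have "z \<in> T closure_of ?E"
    using z by (auto simp: in_derived_set_of in_closure_of)
  then have "\<not> closedin T ?E"
    using closure_of_closedin by fastforce
  then obtain \<epsilon> x where \<epsilon>: "range \<epsilon> \<subseteq> ?E" "x \<notin> ?E" "limitin T \<epsilon> x sequentially"
    using T(2) ET unfolding sequential_space_def by blast
  then have "\<forall>i. \<exists>k. \<epsilon> i = \<sigma> k" by blast
  then obtain k where k: "\<And>i. \<epsilon> i = \<sigma> (k i)" by metis
  \<comment> \<open>If an index \<open>m\<close> recurred infinitely often, the limit
    \<open>x\<close> would be \<open>\<sigma> m\<close>, a member of \<open>?E\<close>.\<close>
  have "finite {i. k i = m}" for m
  proof (rule ccontr)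
    assume "infinite {i. k i = m}"
    then have "\<exists>\<^sub>F i in sequentially. k i = m"
      by (simp add: frequently_cofinite flip: cofinite_eq_sequentially)
    then have "\<exists>\<^sub>F i in sequentially. \<epsilon> i \<in> {\<sigma> m}"
      by (rule frequently_elim1) (simp add: k)
    moreover have "closedin T {\<sigma> m}"
      using finite_imp_closedin_Hausdorff[OF T(1), of "{\<sigma> m}"] K compactin_subset_topspace[OF K(1)] by blast
    ultimately have "x = \<sigma> m"
      using limitin_frequently_closedin[OF \<epsilon>(3)] by blast
    moreover have "\<sigma> m \<in> ?E"
    proof -
      obtain i where "k i = m"
        using \<open>infinite {i. k i = m}\<close> not_finite_existsD by blast
      then show ?thesis using \<epsilon>(1) k[of i] by auto
    qed
    ultimately show False using \<epsilon>(2) by simp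
  qed
  then obtain r :: "nat \<Rightarrow> nat" where r: "strict_mono r" "strict_mono (k \<circ> r)"
    by (rule finite_to_one_imp_strict_mono)
  have eq: "\<sigma> \<circ> (k \<circ> r) = \<epsilon> \<circ> r"
    by (simp add: fun_eq_iff k)
  show thesis
    by (rule that[OF r(2), of x]) (simp only: eq limitin_subsequence[OF r(1) \<epsilon>(3)])
qed

lemma sequential_space_closed_subtopology:
  assumes "sequential_space T" "closedin T C"
  shows "sequential_space (subtopology T C)"
  unfolding sequential_space_def
proof (intro allI impI)
  fix A assume A: "A \<subseteq> topspace (subtopology T C)" "\<not> closedin (subtopology T C) A"
  have "\<not> closedin T A"
    using A assms(2) closedin_closed_subtopology by fastforce
  then obtain \<sigma> x where s: "range \<sigma> \<subseteq> A" "x \<notin> A" "limitin T \<sigma> x sequentially"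
    using assms(1) A(1) unfolding sequential_space_def topspace_subtopology by blast
  moreover have "x \<in> C"
    using limitin_closedin[OF s(3) assms(2)] s(1) A(1) by (force simp: eventually_sequentially)
  ultimately show "\<exists>\<sigma> x. range \<sigma> \<subseteq> A \<and> x \<notin> A \<and> limitin (subtopology T C) \<sigma> x sequentially"
    using A(1) by (auto simp: limitin_subtopology intro!: exI[of _ \<sigma>] exI[of _ x] eventuallyI)
qed

section \<open>Compact exhaustion of a k_omega space\<close>

text \<open>The exhaustion consists of finite unions of members of the family. If a convergent
  sequence had only finitely many terms in each member, its terms other than the limit would form a
  closed set, their traces on the members being finite. The sequence would then be eventually
  constant and stay in a member containing its limit.\<close>

lemma k_omega_space_exhaustion:
  assumes T: "k_omega_space T" "Hausdorff_space T"
  obtains K :: "nat \<Rightarrow> 'a set" where "\<And>n. compactin T (K n)" "incseq K"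
    "\<And>\<sigma> x. limitin T \<sigma> x sequentially \<Longrightarrow> \<exists>n. \<exists>\<^sub>F k in sequentially. \<sigma> k \<in> K n"
proof -
  obtain \<K> \<tau> where cnt: "countable \<K>" and cover: "\<Union>\<K> = topspace T"
    and det: "determined_by T \<K> \<tau>"
    and cpt: "\<And>K. K \<in> \<K> \<Longrightarrow> compact_space (\<tau> K)"
    and haus: "\<And>K. K \<in> \<K> \<Longrightarrow> Hausdorff_space (\<tau> K)"
    using T(1) unfolding k_omega_space_def by (elim exE conjE) (rule that, auto)
  have top: "topspace (\<tau> K) = K" and sub: "K \<subseteq> topspace T" if "K \<in> \<K>" for K
    using det that by (auto simp: determined_by_def)
  have comp: "compactin T K" if "K \<in> \<K>" for K
  proof -
    \<comment> \<open>\<open>\<tau> K\<close> is not given as the subspace topology, so its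
      compactness is carried over to \<open>T\<close> by the continuous identity map.\<close>
    have "continuous_map (\<tau> K) T id"
      unfolding continuous_map_def
    proof (intro conjI allI impI)
      fix U assume U: "openin T U"
      have "{x \<in> topspace (\<tau> K). id x \<in> U} = U \<inter> K"
        using top[OF that] by auto
      then show "openin (\<tau> K) {x \<in> topspace (\<tau> K). id x \<in> U}"
        using det that U openin_subset[OF U] by (simp add: determined_by_def)
    qed (use top[OF that] sub[OF that] in auto)
    then have "compactin T (id ` topspace (\<tau> K))"
      using cpt[OF that] image_compactin compact_space_def by blast
    then show ?thesis by (simp add: top[OF that])
  qed
  show thesis
  proof (cases "\<K> = {}")
    case True
    then show thesis
      using cover that[of "\<lambda>_. {}"] limitin_topspace by (fastforce simp: incseq_def)
  next
    case False
    define e where "e = from_nat_into \<K>"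
    define K where "K n = (\<Union>i<n. e i)" for n
    have e: "e i \<in> \<K>" for i
      by (simp add: e_def False from_nat_into)
    have surj: "\<exists>i. e i = F" if "F \<in> \<K>" for F
      using that cnt by (metis e_def from_nat_into_surj)
    show thesis
    proof (rule that[of K])
      show "compactin T (K n)" for n
        unfolding K_def using e comp by (auto intro: compactin_Union)
      show "incseq K"
        unfolding K_def incseq_def by (intro allI impI UN_mono) auto
      fix \<sigma> x assume lim: "limitin T \<sigma> x sequentially"
      show "\<exists>n. \<exists>\<^sub>F k in sequentially. \<sigma> k \<in> K n"
      proof (rule ccontr)
        assume "\<nexists>n. \<exists>\<^sub>F k in sequentially. \<sigma> k \<in> K n"
        then have fin: "finite {k. \<sigma> k \<in> K n}" for n
          by (auto simp: frequently_cofinite simp flip: cofinite_eq_sequentially)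
        have fin': "finite {k. \<sigma> k \<in> F}" if "F \<in> \<K>" for F
        proof -
          obtain i where "e i = F" using surj \<open>F \<in> \<K>\<close> by blast
          then have "{k. \<sigma> k \<in> F} \<subseteq> {k. \<sigma> k \<in> K (Suc i)}" by (auto simp: K_def)
          then show ?thesis using fin finite_subset by blast
        qed
        \<comment> \<open>Finitely many terms of a convergent sequence may lie outside
          \<open>topspace T\<close>, whence the intersection.\<close>
        define D where "D = (range \<sigma> - {x}) \<inter> topspace T"
        have "openin (\<tau> F) ((topspace T - D) \<inter> F)" if "F \<in> \<K>" for F
        proof -
          have "D \<inter> F \<subseteq> \<sigma> ` {k. \<sigma> k \<in> F}" by (auto simp: D_def)
          then have "finite (D \<inter> F)"
            using fin'[OF that] finite_surj by blast
          then have "closedin (\<tau> F) (D \<inter> F)"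
            using finite_imp_closedin_Hausdorff[OF haus[OF that]] top[OF that] by simp
          then have "openin (\<tau> F) (F - D \<inter> F)"
            using top[OF that] by (metis openin_diff openin_topspace)
          moreover have "(topspace T - D) \<inter> F = F - D \<inter> F"
            using sub[OF that] by blast
          ultimately show ?thesis by simp
        qed
        then have "openin T (topspace T - D)"
          using det by (auto simp: determined_by_def)
        moreover have "x \<in> topspace T - D"
          using limitin_topspace[OF lim] by (simp add: D_def)
        ultimately have "\<forall>\<^sub>F k in sequentially. \<sigma> k \<in> topspace T - D"
          using lim unfolding limitin_def by blast
        then have ev: "\<forall>\<^sub>F k in sequentially. \<sigma> k = x"
          by (rule eventually_mono) (auto simp: D_def)
        obtain F where F: "F \<in> \<K>" "x \<in> F"
          using limitin_topspace[OF lim] cover by blast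
        have "\<forall>\<^sub>F k in sequentially. \<sigma> k \<notin> F"
          using fin'[OF F(1)] by (simp add: eventually_cofinite flip: cofinite_eq_sequentially)
        with ev have "\<forall>\<^sub>F k in sequentially. False"
          by eventually_elim (use F in auto)
        then show False by simp
      qed
    qed
  qed
qed

section \<open>Countable local \<pi>-bases\<close>

text \<open>Members of \<open>\<B>\<close> need not contain \<open>p\<close>. If there is no such
  family, a recursion of length \<omega>_1 builds a free sequence in \<open>L\<close>: complementary
  initial and final segments have disjoint closures. Sequentiality makes the union of the closures
  of the initial segments closed, while compactness gives a point in the closures of all final
  segments; these facts are incompatible.\<close>

lemma sequential_space_countable_local_pi_base:
  fixes T :: "'a topology"
  assumes T: "regular_space T" "sequential_space T"
    and L: "compactin T L" "openin T \<Lambda>" "p \<in> \<Lambda>" "\<Lambda> \<subseteq> L"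
  obtains \<B> where "countable \<B>" "\<And>B. B \<in> \<B> \<Longrightarrow> openin T B \<and> B \<noteq> {}"
    "\<And>W. openin T W \<Longrightarrow> p \<in> W \<Longrightarrow> \<exists>B\<in>\<B>. B \<subseteq> W"
proof (rule ccontr)
  note base = that
  assume neg: "\<not> thesis"
  have no_base: "\<exists>W. openin T W \<and> p \<in> W \<and> (\<forall>B\<in>\<B>. \<not> B \<subseteq> W)"
    if "countable \<B>" "\<And>B. B \<in> \<B> \<Longrightarrow> openin T B \<and> B \<noteq> {}" for \<B>
    using base[OF that] neg by blast
  have pT: "p \<in> topspace T"
    using L openin_subset by blast
  have shrink: "\<exists>V. openin T V \<and> p \<in> V \<and> T closure_of V \<subseteq> W" if W: "openin T W" "p \<in> W" for W
  proof -
    have "closedin T (topspace T - W)" "p \<in> topspace T - (topspace T - W)"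
      using W pT by auto
    then obtain V where "openin T V" "p \<in> V" "disjnt (topspace T - W) (T closure_of V)"
      using T(1) unfolding regular_space by blast
    then show ?thesis
      using closure_of_subset_topspace[of T V] by (auto simp: disjnt_iff)
  qed
  obtain I :: "nat set set" and R :: "nat set rel" where R: "wf R" "trans R" "total_on I R" "R \<subseteq> I \<times> I"
    and I: "uncountable I" and cnt: "\<And>i. countable {j. (j, i) \<in> R}"
    using omega_one_well_order by metis
  text \<open>Each \<open>i\<close> gets neighbourhoods \<open>V' i\<close> and \<open>V i\<close> of \<open>p\<close> such that no set generated by the earlier
    \<open>V' j\<close> and exteriors of \<open>V j\<close> lies in the closure of \<open>V i\<close>; so the exterior of \<open>V i\<close> meets all of them.\<close>
  define ext where "ext V = topspace T - T closure_of V" for V :: "'a set"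
  define gen where "gen f i = (\<Union>j\<in>{j. (j, i) \<in> R}. {fst (f j), ext (snd (f j))})"
    for f :: "nat set \<Rightarrow> 'a set \<times> 'a set" and i
  define \<B> where "\<B> f i = {B. \<exists>E. finite E \<and> E \<subseteq> gen f i \<and> B = \<Lambda> \<inter> \<Inter>E \<and> B \<noteq> {}}"
    for f :: "nat set \<Rightarrow> 'a set \<times> 'a set" and i
  define P where "P f i = (\<lambda>(V', V). openin T V' \<and> p \<in> V' \<and> T closure_of V' \<subseteq> V \<and> openin T V \<and>
      (\<forall>B\<in>\<B> f i. \<not> B \<subseteq> T closure_of V))"
    for f :: "nat set \<Rightarrow> 'a set \<times> 'a set" and i
  have "\<exists>f. \<forall>i. P f i (f i)"
  proof (rule dependent_wf_choice[OF R(1)])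
    fix f g :: "nat set \<Rightarrow> 'a set \<times> 'a set" and i r
    assume "\<And>j. (j, i) \<in> R \<Longrightarrow> f j = g j"
    then have "gen f i = gen g i" by (auto simp: gen_def)
    then show "P f i r = P g i r" by (simp add: P_def \<B>_def)
  next
    fix i and f :: "nat set \<Rightarrow> 'a set \<times> 'a set"
    assume IH: "\<And>j. (j, i) \<in> R \<Longrightarrow> P f j (f j)"
    have "countable (gen f i)"
      unfolding gen_def by (intro countable_UN cnt) simp
    then have "countable {E. finite E \<and> E \<subseteq> gen f i}"
      by (rule countable_Collect_finite_subset)
    moreover have "\<B> f i \<subseteq> (\<lambda>E. \<Lambda> \<inter> \<Inter>E) ` {E. finite E \<and> E \<subseteq> gen f i}"
      by (auto simp: \<B>_def)
    ultimately have "countable (\<B> f i)"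
      by (meson countable_image countable_subset)
    moreover have "openin T B \<and> B \<noteq> {}" if "B \<in> \<B> f i" for B
    proof -
      obtain E where E: "finite E" "E \<subseteq> gen f i" "B = \<Lambda> \<inter> \<Inter>E" "B \<noteq> {}"
        using \<open>B \<in> \<B> f i\<close> by (auto simp: \<B>_def)
      have "openin T S" if "S \<in> gen f i" for S
        using that IH by (fastforce simp: gen_def P_def ext_def split_beta)
      then have "openin T (\<Inter>(insert \<Lambda> E))"
        using E L by (intro openin_Inter) auto
      then show ?thesis using E by simp
    qed
    ultimately obtain W where W: "openin T W" "p \<in> W" "\<forall>B\<in>\<B> f i. \<not> B \<subseteq> W"
      using no_base by meson
    obtain V where V: "openin T V" "p \<in> V" "T closure_of V \<subseteq> W"
      using shrink[OF W(1,2)] by blast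
    obtain V' where V': "openin T V'" "p \<in> V'" "T closure_of V' \<subseteq> V"
      using shrink[OF V(1,2)] by blast
    have "\<not> B \<subseteq> T closure_of V" if "B \<in> \<B> f i" for B
      using W(3) V(3) that by blast
    then have "P f i (V', V)"
      using V V' by (simp add: P_def)
    then show "\<exists>r. P f i r" ..
  qed
  then obtain f where f: "\<And>i. P f i (f i)" by blast
  define V' V where "V' i = fst (f i)" and "V i = snd (f i)" for i
  have V': "openin T (V' i)" "p \<in> V' i" "T closure_of V' i \<subseteq> V i" and V: "openin T (V i)"
    and big: "\<And>B. B \<in> \<B> f i \<Longrightarrow> \<not> B \<subseteq> T closure_of V i" for i
    using f[of i] by (auto simp: P_def V'_def V_def split_beta)
  \<comment> \<open>For fixed \<open>i\<close>, \<open>side i j\<close> chooses the side of the cut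
    at \<open>j\<close> for the point \<open>x i\<close>: near \<open>p\<close> if \<open>j\<close>
    is below \<open>i\<close>, away from \<open>p\<close> otherwise. \<open>cside\<close> is a
    closed enlargement, to which compactness applies.\<close>
  define side where "side i j = (if (j, i) \<in> R then V' j else ext (V j))" for i j
  define cside where "cside i j = (if (j, i) \<in> R then T closure_of V' j else topspace T - V j)" for i j
  have side_cside: "side i j \<subseteq> cside i j" for i j
    using V'(1)[of j] V[of j] closure_of_subset openin_subset
    unfolding side_def cside_def ext_def by (smt (verit) Diff_mono order_refl)
  have cside_closed: "closedin T (cside i j)" for i j
    using V by (simp add: cside_def openin_diff closedin_diff)
  have finite_has_max: "\<exists>m\<in>F. \<forall>j\<in>F - {m}. (j, m) \<in> R" if "finite F" "F \<noteq> {}" "F \<subseteq> I" for F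
    using that
  proof (induction F rule: finite_ne_induct)
    case (singleton x)
    then show ?case by simp
  next
    case (insert x F)
    have xF: "x \<in> I" "F \<subseteq> I" using insert.prems by simp_all
    obtain m where m: "m \<in> F" "\<forall>j\<in>F - {m}. (j, m) \<in> R"
      using insert.IH[OF xF(2)] by (elim bexE)
    have "m \<in> I" "x \<noteq> m" using m(1) xF(2) insert.hyps(3) by auto
    then have comp: "(x, m) \<in> R \<or> (m, x) \<in> R"
      using R(3) xF(1) unfolding total_on_def by simp
    show ?case
    proof (cases "(x, m) \<in> R")
      case True
      then show ?thesis using m by blast
    next
      case False
      with comp have "(m, x) \<in> R" by simp
      then have "\<forall>j\<in>F. (j, x) \<in> R"
        using m R(2) by (metis DiffI empty_iff insert_iff transD)
      then show ?thesis by blast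
    qed
  qed
  \<comment> \<open>The largest index \<open>m\<close> of \<open>F\<close> is split off. If
    \<open>m\<close> is below \<open>i\<close>, so is all of \<open>F\<close>, and \<open>p\<close>
    itself works. Otherwise the intersection over \<open>F - {m}\<close> belongs to
    \<open>\<B> f m\<close>, so it is not inside the closure of \<open>V m\<close> and meets the
    exterior of \<open>V m\<close>.\<close>
  have fin_ne: "\<Lambda> \<inter> \<Inter>(side i ` F) \<noteq> {}" if "finite F" "F \<subseteq> I" for i F
    using that
  proof (induction "card F" arbitrary: F)
    case 0
    then show ?case using L by auto
  next
    case (Suc n)
    then have "F \<noteq> {}" by auto
    obtain m where m: "m \<in> F" "\<And>j. j \<in> F - {m} \<Longrightarrow> (j, m) \<in> R"
      using finite_has_max[OF Suc.prems(1) \<open>F \<noteq> {}\<close> Suc.prems(2)] by blast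
    show ?case
    proof (cases "(m, i) \<in> R")
      case True
      then have "(j, i) \<in> R" if "j \<in> F" for j
        using m(2)[of j] that R(2) by (cases "j = m") (auto dest: transD)
      then have "p \<in> \<Lambda> \<inter> \<Inter>(side i ` F)"
        using V' L by (auto simp: side_def)
      then show ?thesis by blast
    next
      case False
      let ?B = "\<Lambda> \<inter> \<Inter>(side i ` (F - {m}))"
      have "?B \<noteq> {}"
        using Suc m(1) by (intro Suc.hyps(1)) auto
      moreover have "side i ` (F - {m}) \<subseteq> gen f m"
      proof (rule image_subsetI)
        fix j assume "j \<in> F - {m}"
        moreover have "side i j \<in> {fst (f j), ext (snd (f j))}"
          by (simp add: side_def V'_def V_def)
        ultimately show "side i j \<in> gen f m"
          using m(2) unfolding gen_def by blast
      qed
      moreover have "finite (side i ` (F - {m}))" using Suc.prems(1) by simp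
      ultimately have "?B \<in> \<B> f m"
        unfolding \<B>_def by blast
      then obtain y where "y \<in> ?B" "y \<notin> T closure_of V m"
        using big by blast
      moreover have "y \<in> topspace T"
        using \<open>y \<in> ?B\<close> L openin_subset by blast
      ultimately have "y \<in> \<Lambda> \<inter> \<Inter>(side i ` F)"
        using False by (auto simp: side_def ext_def)
      then show ?thesis by blast
    qed
  qed
  have "L \<inter> \<Inter>(cside i ` I) \<noteq> {}" for i
  proof -
    have "L \<inter> \<Inter>\<F> \<noteq> {}" if fin: "finite \<F>" "\<F> \<subseteq> cside i ` I" for \<F>
    proof -
      obtain F where F: "finite F" "F \<subseteq> I" "\<F> = cside i ` F"
        using fin by (meson finite_subset_image)
      show ?thesis
        using fin_ne[OF F(1,2), of i] side_cside[of i] L(4) unfolding F(3) by blast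
    qed
    moreover have "\<forall>C\<in>cside i ` I. closedin T C"
      using cside_closed by blast
    ultimately show ?thesis
      using L(1) unfolding compactin_fip by (metis (no_types, lifting))
  qed
  then have "\<forall>i. \<exists>x. x \<in> L \<and> (\<forall>j\<in>I. x \<in> cside i j)" by blast
  then obtain x where xL: "\<And>i. x i \<in> L" and x: "\<And>i j. j \<in> I \<Longrightarrow> x i \<in> cside i j"
    by metis
  have LT: "L \<subseteq> topspace T" by (rule compactin_subset_topspace[OF L(1)])
  text \<open>The \<open>x i\<close> form a free sequence: \<open>V' j\<close> and \<open>V j\<close> separate the points up to \<open>j\<close> from those beyond \<open>j\<close>.\<close>
  have bounded: "\<exists>j\<in>I. \<forall>i\<in>C. (i, j) \<in> R" if "countable C" "C \<subseteq> I" for C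
  proof (rule ccontr)
    assume *: "\<not> ?thesis"
    \<comment> \<open>Without a bound, countably many countable initial segments would cover
      \<open>I\<close>.\<close>
    have "I \<subseteq> (\<Union>i\<in>C. insert i {j. (j, i) \<in> R})"
    proof
      fix j assume "j \<in> I"
      with * obtain i where "i \<in> C" "(i, j) \<notin> R" by blast
      then show "j \<in> (\<Union>i\<in>C. insert i {j. (j, i) \<in> R})"
        using R(3) \<open>j \<in> I\<close> that(2) by (auto simp: total_on_def)
    qed
    moreover have "countable (\<Union>i\<in>C. insert i {j. (j, i) \<in> R})"
      using that(1) cnt by auto
    ultimately show False
      using I countable_subset by blast
  qed
  have x_lower: "x i \<in> topspace T - V j" if "j \<in> I" "(j, i) \<notin> R" for i j
    using x[OF that(1), of i] that(2) by (simp add: cside_def)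
  have x_upper: "x i \<in> T closure_of V' j" if "j \<in> I" "(j, i) \<in> R" for i j
    using x[OF that(1), of i] that(2) by (simp add: cside_def)
  \<comment> \<open>The index \<open>j\<close> itself counts for \<open>lower j\<close>, which later
    puts \<open>x i\<close> into \<open>lower i\<close>.\<close>
  define lower where "lower j = x ` {i\<in>I. (j, i) \<notin> R}" for j
  define upper where "upper j = x ` {i\<in>I. (j, i) \<in> R}" for j
  have lower: "T closure_of lower j \<subseteq> topspace T - V j" if "j \<in> I" for j
  proof (rule closure_of_minimal)
    show "lower j \<subseteq> topspace T - V j"
      using x_lower[OF that] unfolding lower_def by blast
    show "closedin T (topspace T - V j)" using V by (simp add: closedin_diff)
  qed
  have upper: "T closure_of upper j \<subseteq> V j" if "j \<in> I" for j
  proof -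
    have "upper j \<subseteq> T closure_of V' j"
      using x_upper[OF that] unfolding upper_def by blast
    then have "T closure_of upper j \<subseteq> T closure_of V' j"
      by (intro closure_of_minimal) simp_all
    then show ?thesis using V' by blast
  qed
  have lower_mono: "lower j \<subseteq> lower k" if "(j, k) \<in> R" for j k
    using that R(2) by (auto simp: lower_def dest: transD)
  let ?Z = "\<Union>j\<in>I. T closure_of lower j"
  \<comment> \<open>A sequence in \<open>?Z\<close> involves only countably many indices; they have
    a common upper bound \<open>k\<close>, so the limit lies in the closure of
    \<open>lower k\<close>.\<close>
  have "closedin T ?Z"
  proof (rule closedin_sequential_space[OF T(2)])
    show "?Z \<subseteq> topspace T" using closure_of_subset_topspace by fast
    fix \<sigma> z assume z: "range \<sigma> \<subseteq> ?Z" "limitin T \<sigma> z sequentially"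
    then have "\<forall>n. \<exists>j. j \<in> I \<and> \<sigma> n \<in> T closure_of lower j" by blast
    then obtain j where j: "\<And>n. j n \<in> I" "\<And>n. \<sigma> n \<in> T closure_of lower (j n)" by metis
    obtain k where k: "k \<in> I" "\<And>n. (j n, k) \<in> R"
      using bounded[of "range j"] j(1) by auto
    have "\<sigma> n \<in> T closure_of lower k" for n
      using j(2) closure_of_mono[OF lower_mono[OF k(2)]] by blast
    then have "z \<in> T closure_of lower k"
      by (intro limitin_closedin[OF z(2)]) auto
    then show "z \<in> ?Z" using k(1) by blast
  qed
  \<comment> \<open>Finitely many indices have an upper bound \<open>k\<close>, and
    \<open>x k\<close> lies in all the corresponding final segments.\<close>
  have "L \<inter> \<Inter>((\<lambda>j. T closure_of upper j) ` I) \<noteq> {}"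
  proof -
    have "L \<inter> \<Inter>\<F> \<noteq> {}" if fin: "finite \<F>" "\<F> \<subseteq> (\<lambda>j. T closure_of upper j) ` I" for \<F>
    proof -
      obtain F where F: "finite F" "F \<subseteq> I" "\<F> = (\<lambda>j. T closure_of upper j) ` F"
        using fin by (meson finite_subset_image)
      obtain k where k: "k \<in> I" "\<forall>j\<in>F. (j, k) \<in> R"
        using bounded[OF countable_finite[OF F(1)] F(2)] by blast
      have "x k \<in> T closure_of upper j" if "j \<in> F" for j
      proof -
        have "upper j \<subseteq> T closure_of upper j"
          using xL LT by (intro closure_of_subset) (auto simp: upper_def)
        then show ?thesis using k that by (auto simp: upper_def)
      qed
      then show ?thesis using xL unfolding F(3) by blast
    qed
    then show ?thesis
      using L(1) unfolding compactin_fip by (metis (no_types, lifting) closedin_closure_of imageE)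
  qed
  then obtain z where z: "z \<in> L" "\<And>j. j \<in> I \<Longrightarrow> z \<in> T closure_of upper j" by blast
  have "upper j \<subseteq> ?Z" for j
  proof
    fix y assume "y \<in> upper j"
    then obtain i where i: "i \<in> I" "y = x i" by (auto simp: upper_def)
    have "(i, i) \<notin> R" using R(1) by simp
    then have "y \<in> lower i" using i by (auto simp: lower_def)
    moreover have "lower i \<subseteq> T closure_of lower i"
      using xL LT by (intro closure_of_subset) (auto simp: lower_def)
    ultimately show "y \<in> ?Z" using i by blast
  qed
  then have "T closure_of upper j \<subseteq> ?Z" for j
    using \<open>closedin T ?Z\<close> closure_of_minimal by metis
  moreover obtain j0 where "j0 \<in> I" using I by (metis countable_empty ex_in_conv)
  \<comment> \<open>Now \<open>z\<close> is in the closure of some \<open>lower j\<close>, outside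
    \<open>V j\<close>, and in the closure of \<open>upper j\<close>, inside
    \<open>V j\<close>.\<close>
  ultimately have "z \<in> ?Z" using z(2) by blast
  then obtain j where "j \<in> I" "z \<in> T closure_of lower j" by blast
  then show False
    using lower upper z(2) by blast
qed

section \<open>Topological groups: continuity, neighbourhoods of \<open>\<one>\<close>,
  regularity\<close>

context topological_group
begin

lemma openin_subset_carrier: "openin T U \<Longrightarrow> U \<subseteq> carrier G"
  using openin_subset topspace_eq_carrier by metis

lemma continuous_map_mult:
  assumes "continuous_map X T f" "continuous_map X T g"
  shows "continuous_map X T (\<lambda>x. f x \<otimes> g x)"
proof -
  have "continuous_map X (prod_topology T T) (\<lambda>x. (f x, g x))"
    using assms by (simp add: continuous_map_pairedI)
  from continuous_map_compose[OF this continuous_mult] show ?thesis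
    by (simp add: o_def)
qed

lemma continuous_map_inv:
  assumes "continuous_map X T f"
  shows "continuous_map X T (\<lambda>x. inv (f x))"
  using continuous_map_compose[OF assms continuous_inv] by (simp add: o_def)

lemma continuous_map_const_carrier: "a \<in> carrier G \<Longrightarrow> continuous_map X T (\<lambda>x. a)"
  by (simp add: topspace_eq_carrier)

lemma limitin_mult:
  assumes "limitin T f a F" "limitin T g b F"
  shows "limitin T (\<lambda>x. f x \<otimes> g x) (a \<otimes> b) F"
proof -
  have "limitin (prod_topology T T) (\<lambda>x. (f x, g x)) (a, b) F"
    using assms by (simp add: limitin_pairwise o_def)
  from continuous_map_limit[OF continuous_mult this] show ?thesis
    by (simp add: o_def)
qed

lemma limitin_inv:
  assumes "limitin T f a F"
  shows "limitin T (\<lambda>x. inv (f x)) (inv a) F"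
  using continuous_map_limit[OF continuous_inv assms] by (simp add: o_def)

lemma limitin_const_carrier: "a \<in> carrier G \<Longrightarrow> limitin T (\<lambda>x. a) a F"
  by (simp add: topspace_eq_carrier)

lemma openin_preimage:
  assumes "continuous_map T T f" "openin T U"
  shows "openin T {x \<in> carrier G. f x \<in> U}"
  using openin_continuous_map_preimage[OF assms] by (simp add: topspace_eq_carrier)

lemma openin_left_translate:
  assumes "a \<in> carrier G" "openin T U"
  shows "openin T {x \<in> carrier G. a \<otimes> x \<in> U}"
proof (rule openin_preimage[OF _ assms(2)])
  show "continuous_map T T ((\<otimes>) a)"
    using assms by (intro continuous_map_mult continuous_map_const_carrier continuous_map_id[unfolded id_def])
qed

lemma nhd_one_square:
  assumes f: "continuous_map (prod_topology T T) T f" "f (\<one>, \<one>) \<in> W" and W: "openin T W"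
  obtains V where "openin T V" "\<one> \<in> V" "\<And>x y. x \<in> V \<Longrightarrow> y \<in> V \<Longrightarrow> f (x, y) \<in> W"
proof -
  let ?S = "{z \<in> topspace (prod_topology T T). f z \<in> W}"
  have "openin (prod_topology T T) ?S"
    by (rule openin_continuous_map_preimage[OF f(1) W])
  moreover have "(\<one>, \<one>) \<in> ?S"
    using f(2) by (simp add: topspace_eq_carrier)
  ultimately have "\<exists>U V. openin T U \<and> openin T V \<and> \<one> \<in> U \<and> \<one> \<in> V \<and> U \<times> V \<subseteq> ?S"
    unfolding openin_prod_topology_alt by simp
  then obtain U V where UV: "openin T U" "openin T V" "\<one> \<in> U" "\<one> \<in> V" "U \<times> V \<subseteq> ?S"
    by (elim exE conjE)
  show thesis
  proof (rule that[of "U \<inter> V"])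
    show "f (x, y) \<in> W" if "x \<in> U \<inter> V" "y \<in> U \<inter> V" for x y
      using UV(5) that by blast
  qed (use UV in auto)
qed

lemma nhd_one_mult:
  assumes "openin T W" "\<one> \<in> W"
  obtains V where "openin T V" "\<one> \<in> V" "\<And>x y. x \<in> V \<Longrightarrow> y \<in> V \<Longrightarrow> x \<otimes> y \<in> W"
  using nhd_one_square[OF continuous_mult _ assms(1)] assms(2) by (metis one_closed r_one case_prod_conv)

lemma nhd_one_inv_mult:
  assumes "openin T W" "\<one> \<in> W"
  obtains V where "openin T V" "\<one> \<in> V" "\<And>x y. x \<in> V \<Longrightarrow> y \<in> V \<Longrightarrow> inv x \<otimes> y \<in> W"
proof -
  have c: "continuous_map (prod_topology T T) T (\<lambda>z. inv (fst z) \<otimes> snd z)"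
    by (intro continuous_map_mult continuous_map_inv continuous_map_fst continuous_map_snd)
  obtain V where V: "openin T V" "\<one> \<in> V"
      "\<And>x y. x \<in> V \<Longrightarrow> y \<in> V \<Longrightarrow> inv (fst (x, y)) \<otimes> snd (x, y) \<in> W"
    using nhd_one_square[OF c _ assms(1)] assms(2) by (metis fst_conv snd_conv inv_one one_closed r_one)
  show thesis
    by (rule that[OF V(1,2)]) (use V(3) in simp)
qed

text \<open>With \<open>V0\<inverse> V0\<close> inside \<open>a\<inverse> (G - C)\<close>, the set
  \<open>V = a V0\<inverse>\<close> separates \<open>a\<close> from \<open>C\<close>: if
  \<open>c\<close> were in \<open>C\<close> and in the closure of \<open>V\<close>, its
  neighbourhood \<open>c V0\<inverse>\<close> would meet \<open>V\<close> in some
  \<open>y = a u\<inverse> = c v\<inverse>\<close>, so \<open>c = a u\<inverse> v\<close> would be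
  outside \<open>C\<close>.\<close>

lemma regular: "regular_space T"
  unfolding regular_space
proof (intro allI impI)
  fix C a assume "closedin T C \<and> a \<in> topspace T - C"
  then have C: "closedin T C" and a: "a \<in> carrier G" "a \<notin> C"
    by (auto simp: topspace_eq_carrier)
  let ?W = "{x \<in> carrier G. a \<otimes> x \<in> carrier G - C}"
  have "openin T ?W"
    using C a topspace_eq_carrier by (intro openin_left_translate) (metis closedin_def)+
  moreover have "\<one> \<in> ?W" using a by simp
  ultimately obtain V0 where V0: "openin T V0" "\<one> \<in> V0"
      "\<And>x y. x \<in> V0 \<Longrightarrow> y \<in> V0 \<Longrightarrow> inv x \<otimes> y \<in> ?W"
    using nhd_one_inv_mult by blast
  define V where "V = {x \<in> carrier G. inv a \<otimes> x \<in> {x \<in> carrier G. inv x \<in> V0}}"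
  have inv_open: "openin T {x \<in> carrier G. inv x \<in> V0}"
    by (rule openin_preimage[OF continuous_inv V0(1)])
  have "openin T V"
    unfolding V_def using a by (intro openin_left_translate inv_open) simp
  moreover have "a \<in> V" using a V0 by (simp add: V_def)
  moreover have "c \<notin> T closure_of V" if "c \<in> C" for c
  proof
    assume cV: "c \<in> T closure_of V"
    have c: "c \<in> carrier G"
      using C closedin_subset topspace_eq_carrier that by blast
    let ?U = "{x \<in> carrier G. inv c \<otimes> x \<in> {x \<in> carrier G. inv x \<in> V0}}"
    have "openin T ?U"
      using c by (intro openin_left_translate inv_open) simp
    moreover have "c \<in> ?U" using c V0 by simp
    ultimately obtain y where y: "y \<in> V" "y \<in> ?U"
      by (rule closure_of_meets_openin[OF cV])
    then have yc: "y \<in> carrier G" by simp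
    have "inv (inv a \<otimes> y) \<in> V0" "inv (inv c \<otimes> y) \<in> V0"
      using y by (auto simp: V_def)
    then have "inv (inv (inv a \<otimes> y)) \<otimes> inv (inv c \<otimes> y) \<in> ?W"
      by (rule V0(3))
    moreover have "a \<otimes> (inv (inv (inv a \<otimes> y)) \<otimes> inv (inv c \<otimes> y)) = c"
      using a(1) c yc by (simp add: inv_mult_group m_assoc) (metis inv_closed l_inv r_inv m_assoc m_closed l_one r_one)
    ultimately show False using that by simp
  qed
  ultimately show "\<exists>U. openin T U \<and> a \<in> U \<and> disjnt C (T closure_of U)"
    by (auto simp: disjnt_iff)
qed

section \<open>The Frechet property of locally compact groups\<close>

text \<open>A countable local \<pi>-base becomes a neighbourhood base by passing from
  \<open>B n\<close> to \<open>D n = (B n)\<inverse> (B n)\<close>: this set contains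
  \<open>\<one>\<close>, and it lies in \<open>W\<close> as soon as \<open>B n\<close> lies in a
  \<open>V\<close> with \<open>V\<inverse> V\<close> inside \<open>W\<close>.\<close>

lemma locally_compact_sequential_imp_Frechet:
  assumes T: "sequential_space T"
    and L: "compactin T L" "openin T U" "\<one> \<in> U" "U \<subseteq> L"
  shows "Frechet_space T"
proof -
  obtain \<B> where \<B>: "countable \<B>" "\<And>B. B \<in> \<B> \<Longrightarrow> openin T B \<and> B \<noteq> {}"
      "\<And>W. openin T W \<Longrightarrow> \<one> \<in> W \<Longrightarrow> \<exists>B\<in>\<B>. B \<subseteq> W"
    using sequential_space_countable_local_pi_base[OF regular T L] by metis
  have "\<B> \<noteq> {}" using \<B>(3)[OF L(2,3)] by blast
  define B where "B = from_nat_into \<B>"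
  have B: "openin T (B n)" "B n \<noteq> {}" for n
    using \<B>(2)[OF from_nat_into[OF \<open>\<B> \<noteq> {}\<close>]] by (simp_all add: B_def)
  have B_small: "\<exists>n. B n \<subseteq> W" if "openin T W" "\<one> \<in> W" for W
    using \<B>(3)[OF that] from_nat_into_surj[OF \<B>(1)] unfolding B_def by metis
  define D where "D n = (\<Union>u\<in>B n. {y \<in> carrier G. u \<otimes> y \<in> B n})" for n
  have D_open: "openin T (D n)" for n
    unfolding D_def using B openin_subset_carrier by (intro openin_Union ballI) (auto intro!: openin_left_translate)
  have D_one: "\<one> \<in> D n" for n
    using B[of n] openin_subset_carrier[OF B(1)[of n]] by (auto simp: D_def subset_iff)
  show ?thesis
    unfolding Frechet_space_def
  proof (intro allI impI ballI)
    fix A x assume A: "A \<subseteq> topspace T" and xA: "x \<in> T closure_of A"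
    have x: "x \<in> carrier G"
      using xA by (auto simp: in_closure_of topspace_eq_carrier)
    define N where "N n = {y \<in> carrier G. inv x \<otimes> y \<in> D n}" for n
    \<comment> \<open>The sets \<open>N m\<close> need not decrease, so \<open>a n\<close> is taken
      from the first \<open>n + 1\<close> of them at once.\<close>
    have "\<exists>a\<in>A. \<forall>m\<le>n. a \<in> N m" for n
    proof -
      have "openin T ((\<Inter>m\<in>{..n}. N m) \<inter> topspace T)"
        unfolding N_def using x D_open by (intro openin_INT openin_left_translate) auto
      moreover have "x \<in> (\<Inter>m\<in>{..n}. N m) \<inter> topspace T"
        using x D_one by (simp add: N_def topspace_eq_carrier)
      ultimately obtain y where "y \<in> A" "y \<in> (\<Inter>m\<in>{..n}. N m) \<inter> topspace T"
        by (rule closure_of_meets_openin[OF xA])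
      then show ?thesis by blast
    qed
    then obtain a where a: "\<And>n. a n \<in> A" "\<And>n m. m \<le> n \<Longrightarrow> a n \<in> N m" by metis
    have "limitin T a x sequentially"
      unfolding limitin_def
    proof (intro conjI allI impI)
      show "x \<in> topspace T" using x topspace_eq_carrier by simp
      fix O' assume O': "openin T O' \<and> x \<in> O'"
      let ?W = "{y \<in> carrier G. x \<otimes> y \<in> O'}"
      have "openin T ?W" "\<one> \<in> ?W"
        using O' x openin_left_translate by auto
      then obtain V where V: "openin T V" "\<one> \<in> V" "\<And>u v. u \<in> V \<Longrightarrow> v \<in> V \<Longrightarrow> inv u \<otimes> v \<in> ?W"
        using nhd_one_inv_mult by blast
      obtain m where m: "B m \<subseteq> V" using B_small V by blast
      have "a n \<in> O'" if "m \<le> n" for n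
      proof -
        have an: "a n \<in> carrier G" "inv x \<otimes> a n \<in> D m"
          using a(2)[OF that] by (auto simp: N_def)
        then obtain u where u: "u \<in> B m" "u \<otimes> (inv x \<otimes> a n) \<in> B m"
          by (auto simp: D_def)
        have uc: "u \<in> carrier G" using u B openin_subset_carrier by blast
        have "inv u \<otimes> (u \<otimes> (inv x \<otimes> a n)) \<in> ?W"
          using u m V(3) by blast
        moreover have "inv u \<otimes> (u \<otimes> (inv x \<otimes> a n)) = inv x \<otimes> a n"
          using uc x an(1) by (simp flip: m_assoc)
        moreover have "x \<otimes> (inv x \<otimes> a n) = a n"
          using x an(1) by (simp flip: m_assoc)
        ultimately show ?thesis by simp
      qed
      then show "\<forall>\<^sub>F n in sequentially. a n \<in> O'"
        by (auto simp: eventually_sequentially)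
    qed
    then show "\<exists>\<sigma>. range \<sigma> \<subseteq> A \<and> limitin T \<sigma> x sequentially"
      using a(1) by blast
  qed
qed

section \<open>Null sequences and compact sets\<close>

text \<open>Choosing \<open>p k\<close> so close to \<open>\<one>\<close> that \<open>p j (p k)\<inverse> \<notin> L\<close> for all \<open>j < k\<close> makes the
  quotients of successive terms of a convergent subsequence of \<open>p\<close> the required null sequence.\<close>

lemma null_sequence_outside_compact:
  assumes T: "sequential_space T" and H: "subgroup H G"
    and L: "compactin T L" and K: "compactin T K"
    and cl: "\<one> \<in> T closure_of (H \<inter> K - L)"
  obtains s where "range s \<subseteq> H - L" "limitin T s \<one> sequentially"
proof -
  have HG: "H \<subseteq> carrier G" by (rule subgroup.subset[OF H])
  have Lop: "openin T (topspace T - L)"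
    using compactin_imp_closedin[OF Hausdorff L] by blast
  define P where "P p k r \<longleftrightarrow> r \<in> H \<inter> K - L \<and> (\<forall>j<k. p j \<otimes> inv r \<notin> L)" for p and k :: nat and r
  have "\<exists>p. \<forall>k. P p k (p k)"
  proof (rule dependent_wf_choice[OF wf_less])
    fix f g :: "nat \<Rightarrow> 'a" and k r
    assume "\<And>j. (j, k) \<in> {(x, y). x < y} \<Longrightarrow> f j = g j"
    then show "P f k r = P g k r" by (simp add: P_def)
  next
    fix k and p :: "nat \<Rightarrow> 'a"
    assume IH: "\<And>j. (j, k) \<in> {(x, y). x < y} \<Longrightarrow> P p j (p j)"
    have pj: "p j \<in> carrier G" "p j \<notin> L" if "j < k" for j
      using IH[of j] that HG by (auto simp: P_def)
    \<comment> \<open>Each condition holds at \<open>\<one>\<close> because \<open>p j\<close> is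
      outside \<open>L\<close>, so \<open>?U\<close> is a neighbourhood of
      \<open>\<one>\<close>.\<close>
    let ?U = "(\<Inter>j\<in>{..<k}. {y \<in> carrier G. p j \<otimes> inv y \<in> topspace T - L}) \<inter> topspace T"
    have "openin T ?U"
      using pj(1) by (intro openin_INT openin_preimage[OF _ Lop] continuous_map_mult
          continuous_map_inv continuous_map_const_carrier continuous_map_id[unfolded id_def]) auto
    moreover have "\<one> \<in> ?U"
      using pj by (auto simp: topspace_eq_carrier)
    ultimately obtain r where "r \<in> H \<inter> K - L" "r \<in> ?U"
      by (rule closure_of_meets_openin[OF cl])
    then have "P p k r" by (simp add: P_def)
    then show "\<exists>r. P p k r" ..
  qed
  then obtain p :: "nat \<Rightarrow> 'a" where p: "\<And>k. p k \<in> H \<inter> K - L" "\<And>j k. j < k \<Longrightarrow> p j \<otimes> inv (p k) \<notin> L"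
    unfolding P_def by blast
  obtain r :: "nat \<Rightarrow> nat" and x where r: "strict_mono r" and x: "limitin T (p \<circ> r) x sequentially"
    using compactin_sequential_imp_convergent_subsequence[OF Hausdorff T K, of p] p(1) by blast
  have xc: "x \<in> carrier G" using limitin_topspace[OF x] topspace_eq_carrier by simp
  define s where "s n = p (r n) \<otimes> inv (p (r (Suc n)))" for n
  have "limitin T (\<lambda>n. p (r (Suc n))) x sequentially"
    using limitin_subsequence[OF _ x, of Suc] by (simp add: o_def strict_mono_Suc_iff)
  then have "limitin T s (x \<otimes> inv x) sequentially"
    unfolding s_def using x by (intro limitin_mult limitin_inv) (simp_all add: o_def)
  moreover have "range s \<subseteq> H - L"
    using p r H by (auto simp: s_def strict_mono_Suc_iff subgroup.m_closed subgroup.m_inv_closed)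
  ultimately show thesis
    using that xc by simp
qed

lemma null_sequence_eventually_in:
  assumes no_esc: "\<nexists>s. range s \<subseteq> H - L \<and> limitin T s \<one> sequentially"
    and s: "range s \<subseteq> H" "limitin T s \<one> sequentially"
  shows "\<forall>\<^sub>F n in sequentially. s n \<in> L"
proof (rule ccontr)
  assume "\<not> ?thesis"
  then have "infinite {n. s n \<notin> L}"
    by (simp add: eventually_cofinite flip: cofinite_eq_sequentially)
  then obtain r :: "nat \<Rightarrow> nat" where r: "strict_mono r" "\<forall>n. r n \<in> {n. s n \<notin> L}"
    using infinite_enumerate by (metis (no_types, lifting))
  then have "range (s \<circ> r) \<subseteq> H - L" "limitin T (s \<circ> r) \<one> sequentially"
    using s limitin_subsequence[OF r(1) s(2)] by auto
  then show False using no_esc by blast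
qed

text \<open>The sets \<open>B n = L \<inter> W n \<inter> H\<close> need not be open, but each
  eventually contains every null sequence of \<open>H\<close>, and
  \<open>B (Suc n) B (Suc n) \<subseteq> B n\<close>. Hence the \<open>x\<close> in \<open>H\<close>
  with \<open>x (B n) \<subseteq> B 0\<close> for some \<open>n\<close> form a sequentially open
  set, which contains \<open>\<one>\<close> and lies in \<open>L\<close>.\<close>

lemma no_null_sequence_outside_imp_nhd:
  assumes T: "sequential_space T" and H: "subgroup H G"
    and seqH: "sequential_space (subtopology T H)" and L: "compactin T L"
    and no_esc: "\<nexists>s. range s \<subseteq> H - L \<and> limitin T s \<one> sequentially"
  obtains U where "openin T U" "\<one> \<in> U" "U \<inter> H \<subseteq> L"
proof -
  note esc_eventually = null_sequence_eventually_in[OF no_esc]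
  have HG: "H \<subseteq> carrier G" and one_H: "\<one> \<in> H"
    using H by (simp_all add: subgroup.subset subgroup.one_closed)
  have topH: "topspace (subtopology T H) = H"
    using HG by (auto simp: topspace_eq_carrier)
  have one_L: "\<one> \<in> L"
  proof (rule ccontr)
    assume "\<one> \<notin> L"
    then have "range (\<lambda>n::nat. \<one>) \<subseteq> H - L" using one_H by auto
    then show False
      using no_esc limitin_const_carrier[OF one_closed, of sequentially] by blast
  qed
  \<comment> \<open>Products of elements of \<open>L\<close> lie in \<open>LL\<close>; those that
    are in \<open>H\<close> and close to \<open>\<one>\<close> fall back into \<open>L\<close> by
    the choice of \<open>W0\<close>.\<close>
  define LL where "LL = (\<lambda>(x, y). x \<otimes> y) ` (L \<times> L)"
  have LL: "compactin T LL"
    unfolding LL_def using L by (intro image_compactin[OF _ continuous_mult]) (simp add: compactin_Times)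
  have "\<one> \<notin> T closure_of (H \<inter> LL - L)"
    using null_sequence_outside_compact[OF T H L LL] no_esc by metis
  then obtain W0 where W0: "openin T W0" "\<one> \<in> W0" "W0 \<inter> (H \<inter> LL) \<subseteq> L"
    using topspace_eq_carrier by (fastforce simp: in_closure_of)
  have "\<exists>W. \<forall>n. (openin T (W n) \<and> \<one> \<in> W n \<and> W n \<inter> (H \<inter> LL) \<subseteq> L) \<and>
      (\<forall>x\<in>W (Suc n). \<forall>y\<in>W (Suc n). x \<otimes> y \<in> W n)"
  proof (rule dependent_nat_choice)
    show "\<exists>W. openin T W \<and> \<one> \<in> W \<and> W \<inter> (H \<inter> LL) \<subseteq> L"
      using W0 by blast
    fix W and n :: nat
    assume W: "openin T W \<and> \<one> \<in> W \<and> W \<inter> (H \<inter> LL) \<subseteq> L"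
    then obtain V where V: "openin T V" "\<one> \<in> V" "\<And>x y. x \<in> V \<Longrightarrow> y \<in> V \<Longrightarrow> x \<otimes> y \<in> W"
      using nhd_one_mult by blast
    have "V \<subseteq> W"
    proof
      fix x assume "x \<in> V"
      then show "x \<in> W"
        using V(3)[OF _ V(2)] openin_subset_carrier[OF V(1)] by (metis r_one subsetD)
    qed
    then show "\<exists>V. (openin T V \<and> \<one> \<in> V \<and> V \<inter> (H \<inter> LL) \<subseteq> L) \<and> (\<forall>x\<in>V. \<forall>y\<in>V. x \<otimes> y \<in> W)"
    proof (intro exI[of _ V] conjI ballI)
      show "V \<inter> (H \<inter> LL) \<subseteq> L" using W \<open>V \<subseteq> W\<close> by auto
    qed (simp_all add: V)
  qed
  then obtain W where WP: "\<forall>n. (openin T (W n) \<and> \<one> \<in> W n \<and> W n \<inter> (H \<inter> LL) \<subseteq> L) \<and>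
      (\<forall>x\<in>W (Suc n). \<forall>y\<in>W (Suc n). x \<otimes> y \<in> W n)"
    by (elim exE)
  have W: "openin T (W n)" "\<one> \<in> W n" "W n \<inter> (H \<inter> LL) \<subseteq> L" for n
    using WP by simp_all
  have WW: "x \<otimes> y \<in> W n" if "x \<in> W (Suc n)" "y \<in> W (Suc n)" for x y n
    using WP that by simp
  define B where "B n = L \<inter> W n \<inter> H" for n
  have BB: "x \<otimes> y \<in> B n" if "x \<in> B (Suc n)" "y \<in> B (Suc n)" for x y n
  proof -
    have "x \<otimes> y \<in> W n" "x \<otimes> y \<in> H" "x \<otimes> y \<in> LL"
      using that WW subgroup.m_closed[OF H] by (auto simp: B_def LL_def)
    then show ?thesis using W(3) by (auto simp: B_def)
  qed
  define S where "S = {x \<in> H. \<exists>n. \<forall>y\<in>B n. x \<otimes> y \<in> B 0}"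
  have one_S: "\<one> \<in> S"
    using one_H HG by (auto simp: S_def B_def intro!: exI[of _ 0])
  have S_L: "S \<subseteq> L"
  proof
    fix x assume "x \<in> S"
    then obtain n where x: "x \<in> H" "\<forall>y\<in>B n. x \<otimes> y \<in> B 0" by (auto simp: S_def)
    moreover have "\<one> \<in> B n" using one_L one_H W(2) by (simp add: B_def)
    ultimately have "x \<otimes> \<one> \<in> B 0" by blast
    then show "x \<in> L" using x(1) HG by (auto simp: B_def)
  qed
  have "closedin (subtopology T H) (H - S)"
  proof (rule closedin_sequential_space[OF seqH])
    show "H - S \<subseteq> topspace (subtopology T H)" using topH by blast
    fix \<sigma> x assume \<sigma>: "range \<sigma> \<subseteq> H - S" "limitin (subtopology T H) \<sigma> x sequentially"
    then have lim: "limitin T \<sigma> x sequentially" and xH: "x \<in> H"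
      by (simp_all add: limitin_subtopology)
    show "x \<in> H - S"
    proof (rule ccontr)
      assume "x \<notin> H - S"
      then obtain n where n: "\<And>y. y \<in> B n \<Longrightarrow> x \<otimes> y \<in> B 0"
        using xH by (auto simp: S_def)
      have xG: "x \<in> carrier G" using xH HG by blast
      \<comment> \<open>\<open>t\<close> is a null sequence of \<open>H\<close>, so some
        \<open>t k\<close> is in \<open>B (Suc n)\<close>. Then
        \<open>\<sigma> k (B (Suc n)) = x (t k) (B (Suc n))\<close> lies in \<open>x (B n)\<close>,
        hence in \<open>B 0\<close>, which puts \<open>\<sigma> k\<close> into
        \<open>S\<close>.\<close>
      define t where "t k = inv x \<otimes> \<sigma> k" for k
      have tH: "range t \<subseteq> H"
        using \<sigma>(1) xH H by (auto simp: t_def subgroup.m_closed subgroup.m_inv_closed)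
      have "limitin T t (inv x \<otimes> x) sequentially"
        unfolding t_def using xG lim by (intro limitin_mult limitin_const_carrier) auto
      then have t: "limitin T t \<one> sequentially" using xG by simp
      then have "\<forall>\<^sub>F k in sequentially. t k \<in> W (Suc n)"
        using W(1,2) by (simp add: limitin_def)
      then have "\<forall>\<^sub>F k in sequentially. t k \<in> L \<and> t k \<in> W (Suc n)"
        using esc_eventually[OF tH t] by (simp add: eventually_conj)
      then obtain k where k: "t k \<in> L" "t k \<in> W (Suc n)"
        by (auto simp: eventually_sequentially)
      have tk: "t k \<in> B (Suc n)" using k tH by (auto simp: B_def)
      have \<sigma>k: "\<sigma> k \<in> H" "\<sigma> k \<notin> S" using \<sigma>(1) by auto
      then have \<sigma>G: "\<sigma> k \<in> carrier G" using HG by blast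
      have "\<sigma> k \<otimes> y \<in> B 0" if y: "y \<in> B (Suc n)" for y
      proof -
        have yG: "y \<in> carrier G" using y HG by (auto simp: B_def)
        have "\<sigma> k \<otimes> y = x \<otimes> (t k \<otimes> y)"
          using xG \<sigma>G yG by (simp add: t_def flip: m_assoc)
        then show ?thesis using n[OF BB[OF tk y]] by simp
      qed
      then show False using \<sigma>k by (auto simp: S_def)
    qed
  qed
  then have "openin (subtopology T H) (H - (H - S))"
    using topH by (metis openin_diff openin_topspace)
  moreover have "H - (H - S) = S" by (auto simp: S_def)
  ultimately obtain U where U: "openin T U" "S = U \<inter> H"
    by (auto simp: openin_subtopology)
  show thesis
    by (rule that[OF U(1)]) (use one_S S_L U(2) in auto)
qed

section \<open>Escaping null sequences\<close>

text \<open>In \<open>a n k\<close> the factor \<open>b k\<close> gives column \<open>n\<close> a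
  limit outside \<open>H\<close>, the factor \<open>inv (b n)\<close> makes these limits tend to
  \<open>\<one>\<close>, and the null factor \<open>s n k\<close> pushes the column off
  \<open>K n\<close> without changing its limit.\<close>

lemma escaping_null_sequences_imp_not_sequential:
  assumes K: "\<And>n. compactin T (K n)" "incseq K"
    and K_freq: "\<And>\<sigma> x. limitin T \<sigma> x sequentially \<Longrightarrow> \<exists>n. \<exists>\<^sub>F k in sequentially. \<sigma> k \<in> K n"
    and H: "subgroup H G"
    and b: "range b \<subseteq> H" "limitin T b \<beta> sequentially" "\<beta> \<notin> H"
    and esc: "\<And>L. compactin T L \<Longrightarrow> \<exists>s. range s \<subseteq> H - L \<and> limitin T s \<one> sequentially"
  shows "\<not> sequential_space (subtopology T H)"
proof
  assume seqH: "sequential_space (subtopology T H)"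
  have HG: "H \<subseteq> carrier G" and one_H: "\<one> \<in> H"
    using H by (simp_all add: subgroup.subset subgroup.one_closed)
  have bG: "b n \<in> carrier G" and bH: "b n \<in> H" for n using b(1) HG by auto
  have \<beta>G: "\<beta> \<in> carrier G"
    using limitin_topspace[OF b(2)] topspace_eq_carrier by simp
  define C where "C = insert \<beta> (range b)"
  have C: "compactin T C"
    unfolding C_def using b(1) HG
    by (intro compactin_sequence_with_limit[OF b(2)]) (auto simp: topspace_eq_carrier)
  \<comment> \<open>Adding \<open>\<one>\<close> keeps it out of the set \<open>A\<close>
    below.\<close>
  define K' where "K' n = insert \<one> (K n)" for n
  have K': "compactin T (K' n)" for n
    using compactin_Un[OF finite_imp_compactin[of "{\<one>}" T] K(1)[of n]]
    by (simp add: K'_def topspace_eq_carrier)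
  have div_cont: "continuous_map (prod_topology T T) T (\<lambda>z. inv (fst z) \<otimes> snd z)"
    by (intro continuous_map_mult continuous_map_inv continuous_map_fst continuous_map_snd)
  \<comment> \<open>This is the compact set \<open>C\<inverse> (b n) (K' n)\<close>; if
    \<open>a n k\<close> were in \<open>K' n\<close>, then
    \<open>s n k = (b k)\<inverse> (b n) (a n k)\<close> would lie in \<open>Q n\<close>.\<close>
  define Q where "Q n = (\<lambda>z. inv (fst z) \<otimes> snd z) ` (C \<times> (\<otimes>) (b n) ` K' n)" for n
  have left_cont: "continuous_map T T ((\<otimes>) (b n))" for n
    by (intro continuous_map_mult continuous_map_const_carrier continuous_map_id[unfolded id_def] bG)
  have Q: "compactin T (Q n)" for n
    unfolding Q_def
    by (intro image_compactin[OF _ div_cont])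
       (simp add: compactin_Times C image_compactin[OF K' left_cont])
  have "\<forall>n. \<exists>s. range s \<subseteq> H - Q n \<and> limitin T s \<one> sequentially"
    using esc[OF Q] by blast
  then obtain s where s: "\<And>n. range (s n) \<subseteq> H - Q n" "\<And>n. limitin T (s n) \<one> sequentially"
    by metis
  have sH: "s n k \<in> H" and sG: "s n k \<in> carrier G" and sQ: "s n k \<notin> Q n" for n k
    using s(1)[of n] HG by auto
  define a where "a n k = inv (b n) \<otimes> (b k \<otimes> s n k)" for n k
  define x where "x n = inv (b n) \<otimes> \<beta>" for n
  have aH: "a n k \<in> H" for n k
    unfolding a_def using bH sH H by (simp add: subgroup.m_closed subgroup.m_inv_closed)
  have aG: "a n k \<in> carrier G" for n k using aH HG by blast
  have aK: "a n k \<notin> K' n" for n k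
  proof
    assume "a n k \<in> K' n"
    then have "inv (b k) \<otimes> (b n \<otimes> a n k) \<in> Q n"
      unfolding Q_def C_def by (intro image_eqI[of _ _ "(b k, b n \<otimes> a n k)"]) auto
    moreover have "b n \<otimes> a n k = b k \<otimes> s n k"
      using bG sG by (simp add: a_def flip: m_assoc)
    moreover have "inv (b k) \<otimes> (b k \<otimes> s n k) = s n k"
      using bG sG by (simp flip: m_assoc)
    ultimately show False using sQ by simp
  qed
  have a_lim: "limitin T (a n) (x n) sequentially" for n
  proof -
    have "limitin T (a n) (inv (b n) \<otimes> (\<beta> \<otimes> \<one>)) sequentially"
      unfolding a_def by (intro limitin_mult limitin_const_carrier inv_closed bG b(2) s(2))
    then show ?thesis using \<beta>G by (simp add: x_def)
  qed
  have x_lim: "limitin T x \<one> sequentially"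
  proof -
    have "limitin T x (inv \<beta> \<otimes> \<beta>) sequentially"
      unfolding x_def by (intro limitin_mult limitin_inv limitin_const_carrier b(2) \<beta>G)
    then show ?thesis using \<beta>G by simp
  qed
  have xH: "x n \<notin> H" for n
  proof
    assume "x n \<in> H"
    then have "b n \<otimes> x n \<in> H" using bH H by (simp add: subgroup.m_closed)
    moreover have "b n \<otimes> x n = \<beta>" using bG \<beta>G by (simp add: x_def flip: m_assoc)
    ultimately show False using b(3) by simp
  qed
  define A where "A = (\<Union>n. range (a n))"
  have AH: "A \<subseteq> H" using aH by (auto simp: A_def)
  have "closedin (subtopology T H) A"
  proof (rule closedin_sequential_space[OF seqH])
    show "A \<subseteq> topspace (subtopology T H)"
      using AH HG by (auto simp: topspace_eq_carrier)
    fix \<sigma> y assume \<sigma>: "range \<sigma> \<subseteq> A" "limitin (subtopology T H) \<sigma> y sequentially"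
    then have lim: "limitin T \<sigma> y sequentially" and yH: "y \<in> H"
      by (simp_all add: limitin_subtopology)
    obtain m where m: "\<exists>\<^sub>F k in sequentially. \<sigma> k \<in> K m"
      using K_freq[OF lim] by blast
    \<comment> \<open>Column \<open>n\<close> avoids \<open>K m\<close> once
      \<open>m \<le> n\<close>, so the terms in \<open>K m\<close> come from the finitely many
      columns in \<open>?Z\<close>. Each column is closed together with its limit, and these limits
      are outside \<open>H\<close>.\<close>
    let ?Z = "\<Union>n\<in>{..<m}. insert (x n) (range (a n))"
    have Z: "closedin T ?Z"
    proof (rule closedin_Union)
      show "closedin T S" if "S \<in> (\<lambda>n. insert (x n) (range (a n))) ` {..<m}" for S
        using that aG by (auto intro!: compactin_imp_closedin[OF Hausdorff]
            compactin_sequence_with_limit[OF a_lim] simp: topspace_eq_carrier)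
    qed simp
    have "\<exists>\<^sub>F k in sequentially. \<sigma> k \<in> ?Z"
      using m
    proof (rule frequently_elim1)
      fix k assume k: "\<sigma> k \<in> K m"
      have "\<sigma> k \<in> A" using \<sigma>(1) by blast
      then obtain n j where nj: "\<sigma> k = a n j" by (auto simp: A_def)
      have "n < m"
      proof (rule ccontr)
        assume "\<not> n < m"
        then have "K m \<subseteq> K n" using K(2) by (simp add: incseq_def)
        then show False using k nj aK[of n j] by (auto simp: K'_def)
      qed
      then show "\<sigma> k \<in> ?Z" using nj by auto
    qed
    then have "y \<in> ?Z" by (rule limitin_frequently_closedin[OF lim Z])
    then show "y \<in> A" using yH xH by (auto simp: A_def)
  qed
  \<comment> \<open>\<open>D\<close> contains the limits of the columns and therefore their limit
    \<open>\<one>\<close>, which lies in \<open>H\<close> but not in \<open>A\<close>.\<close>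
  then obtain D where D: "closedin T D" "A = D \<inter> H"
    by (auto simp: closedin_subtopology)
  have "a n k \<in> D" for n k using D(2) by (auto simp: A_def)
  then have "x n \<in> D" for n
    by (intro limitin_closedin[OF a_lim D(1)]) simp_all
  then have "\<one> \<in> D"
    by (intro limitin_closedin[OF x_lim D(1)]) auto
  then have "\<one> \<in> A" using D(2) one_H by blast
  then obtain n k where "a n k = \<one>" by (auto simp: A_def)
  then show False using aK[of n k] by (simp add: K'_def)
qed

section \<open>Closures of subgroups\<close>

lemma subgroup_closure:
  assumes H: "subgroup H G"
  shows "subgroup (T closure_of H) G"
proof (rule subgroupI)
  have HG: "H \<subseteq> carrier G" by (rule subgroup.subset[OF H])
  show "T closure_of H \<subseteq> carrier G"
    using closure_of_subset_topspace topspace_eq_carrier by metis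
  have "H \<subseteq> T closure_of H"
    using HG by (simp add: closure_of_subset topspace_eq_carrier)
  then show "T closure_of H \<noteq> {}"
    using subgroup.one_closed[OF H] by blast
  show "inv a \<in> T closure_of H" if "a \<in> T closure_of H" for a
  proof -
    have "(\<lambda>x. inv x) ` (T closure_of H) \<subseteq> T closure_of ((\<lambda>x. inv x) ` H)"
      by (rule continuous_map_image_closure_subset[OF continuous_inv])
    also have "\<dots> \<subseteq> T closure_of H"
      using H by (intro closure_of_mono) (auto simp: subgroup.m_inv_closed)
    finally show ?thesis using that by blast
  qed
  show "a \<otimes> c \<in> T closure_of H" if "a \<in> T closure_of H" "c \<in> T closure_of H" for a c
  proof -
    have "(\<lambda>(x, y). x \<otimes> y) ` (prod_topology T T closure_of (H \<times> H))
        \<subseteq> T closure_of ((\<lambda>(x, y). x \<otimes> y) ` (H \<times> H))"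
      by (rule continuous_map_image_closure_subset[OF continuous_mult])
    also have "\<dots> \<subseteq> T closure_of H"
      using H by (intro closure_of_mono) (auto simp: subgroup.m_closed)
    finally show ?thesis using that by (auto simp: closure_of_Times)
  qed
qed

lemma topological_group_subgroup:
  assumes H: "subgroup H G"
  shows "topological_group (G\<lparr>carrier := H\<rparr>) (subtopology T H)"
proof -
  have HG: "H \<subseteq> carrier G" by (rule subgroup.subset[OF H])
  interpret S: group "G\<lparr>carrier := H\<rparr>"
    by (rule subgroup_imp_group[OF H])
  show ?thesis
  proof
    show "topspace (subtopology T H) = carrier (G\<lparr>carrier := H\<rparr>)"
      using HG by (auto simp: topspace_eq_carrier)
    show "Hausdorff_space (subtopology T H)"
      by (rule Hausdorff_space_subtopology[OF Hausdorff])
    have "continuous_map (subtopology (prod_topology T T) (H \<times> H)) T (\<lambda>(x, y). x \<otimes> y)"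
      by (rule continuous_map_from_subtopology[OF continuous_mult])
    then show "continuous_map (prod_topology (subtopology T H) (subtopology T H)) (subtopology T H)
        (\<lambda>(x, y). x \<otimes>\<^bsub>G\<lparr>carrier := H\<rparr>\<^esub> y)"
      using H by (auto simp: subtopology_Times continuous_map_in_subtopology subgroup.m_closed)
    have "continuous_map (subtopology T H) (subtopology T H) (\<lambda>x. inv x)"
      using H continuous_map_from_subtopology[OF continuous_inv]
      by (auto simp: continuous_map_in_subtopology subgroup.m_inv_closed)
    then show "continuous_map (subtopology T H) (subtopology T H) (\<lambda>x. inv\<^bsub>G\<lparr>carrier := H\<rparr>\<^esub> x)"
      by (rule continuous_map_eq) (use m_inv_consistent[OF H] in simp)
  qed
qed

text \<open>Since \<open>L\<close> is closed, a neighbourhood of \<open>\<one>\<close> whose trace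
  on \<open>H\<close> lies in \<open>L\<close> also has its trace on the closure of \<open>H\<close>
  in \<open>L\<close>. So the closure is a locally compact group, sequential as a closed
  subspace.\<close>

lemma sequential_subgroup_imp_Frechet_closure:
  assumes T: "sequential_space T" and H: "subgroup H G"
    and seqH: "sequential_space (subtopology T H)" and L: "compactin T L"
    and no_esc: "\<nexists>s. range s \<subseteq> H - L \<and> limitin T s \<one> sequentially"
  shows "Frechet_space (subtopology T (T closure_of H))"
proof -
  let ?C = "T closure_of H"
  have C: "subgroup ?C G" by (rule subgroup_closure[OF H])
  interpret C: topological_group "G\<lparr>carrier := ?C\<rparr>" "subtopology T ?C"
    by (rule topological_group_subgroup[OF C])
  obtain U where U: "openin T U" "\<one> \<in> U" "U \<inter> H \<subseteq> L"
    by (rule no_null_sequence_outside_imp_nhd[OF T H seqH L no_esc])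
  have "closedin T L" by (rule compactin_imp_closedin[OF Hausdorff L])
  then have UL: "U \<inter> ?C \<subseteq> L"
    using openin_Int_closure_of_subset[OF U(1), of H] closure_of_minimal[OF U(3)] by blast
  show ?thesis
  proof (rule C.locally_compact_sequential_imp_Frechet)
    show "sequential_space (subtopology T ?C)"
      by (rule sequential_space_closed_subtopology[OF T closedin_closure_of])
    have "compactin T (?C \<inter> L)"
      by (rule closed_Int_compactin[OF closedin_closure_of L])
    then show "compactin (subtopology T ?C) (?C \<inter> L)"
      by (simp add: compactin_subtopology)
    show "openin (subtopology T ?C) (U \<inter> ?C)"
      using U(1) by (auto simp: openin_subtopology)
    show "\<one>\<^bsub>G\<lparr>carrier := ?C\<rparr>\<^esub> \<in> U \<inter> ?C"
      using U(2) subgroup.one_closed[OF C] by simp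
    show "U \<inter> ?C \<subseteq> ?C \<inter> L"
      using UL by blast
  qed
qed

end

theorem proposition3:
  fixes G :: "('a, 'b) monoid_scheme" and T :: "'a topology" and H :: "'a set"
  assumes "topological_group G T"
    and "k_omega_space T"
    and "sequential_space T"
    and "subgroup H G"
    and "\<not> Frechet_space (subtopology T (T closure_of H))"
    and "T closure_of H \<noteq> H"
  shows "\<not> sequential_space (subtopology T H)"
proof
  assume seqH: "sequential_space (subtopology T H)"
  interpret topological_group G T by fact
  have HT: "H \<subseteq> topspace T"
    using subgroup.subset[OF assms(4)] by (simp add: topspace_eq_carrier)
  have "\<not> closedin T H"
    using assms(6) by (simp add: closure_of_eq)
  then obtain b \<beta> where b: "range b \<subseteq> H" "limitin T b \<beta> sequentially" "\<beta> \<notin> H"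
    using closedin_sequential_space[OF assms(3) HT] by blast
  obtain K :: "nat \<Rightarrow> 'a set" where K: "\<And>n. compactin T (K n)" "incseq K"
    "\<And>\<sigma> x. limitin T \<sigma> x sequentially \<Longrightarrow> \<exists>n. \<exists>\<^sub>F k in sequentially. \<sigma> k \<in> K n"
    using k_omega_space_exhaustion[OF assms(2) Hausdorff] by metis
  have "\<exists>s. range s \<subseteq> H - L \<and> limitin T s \<one>\<^bsub>G\<^esub> sequentially" if "compactin T L" for L
  proof (rule ccontr)
    assume "\<not> ?thesis"
    from sequential_subgroup_imp_Frechet_closure[OF assms(3,4) seqH that this] assms(5)
    show False by contradiction
  qed
  from escaping_null_sequences_imp_not_sequential[OF K assms(4) b this] seqH
  show False by contradiction
qed

end
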